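(* Let $m,n$ be positive integers and let $G$ be the $m\times n$ grid $G_{m,n}$. Then $\mathrm{hn}_{cc}(G)=m+n-1$.
   Context: The $m\times n$ grid $G_{m,n}$ has vertex set $\{(i,j):1\le i\le m,\,1\le j\le n\}$ and edges $(i,j)(i,j+1)$ for $1\le i\le m$, $1\le j\le n-1$, and $(i,j)(i+1,j)$ for $1\le i\le m-1$, $1\le j\le n$. A cycle is a closed walk $(v_1,\dots,v_q,v_1)$ with at least one edge in which the only repeated vertex is $v_1$. For $S\subseteq V(G)$ let $I_{cc}(S)=S\cup\{v\in V(G): \text{there is a cycle } C \text{ of } G \text{ with } V(C)\setminus S=\{v\}\}$. A set $S$ is convex if $I_{cc}(S)=S$; $\mathrm{hull}(S)$ is the smallest convex set containing $S$; $S$ is a hull set if $\mathrm{hull}(S)=V(G)$; $\mathrm{hn}_{cc}(G)$ is the minimum cardinality of a hull set of $G$.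
   Formalization: A cycle is required to have at least three vertices, so the closed walk (u,v,u) along a single edge is not counted as a cycle; if it were, any single vertex would be a hull set of the grid and the formula would fail. *)

theory Defs
  imports Main "HOL.Hull"
begin

text \<open>A simple graph is a pair of a vertex set and a set of two-element edges.\<close>

type_synonym 'a ugraph = "'a set \<times> 'a set set"

abbreviation verts :: "'a ugraph \<Rightarrow> 'a set" where
  "verts G \<equiv> fst G"

abbreviation edges :: "'a ugraph \<Rightarrow> 'a set set" where
  "edges G \<equiv> snd G"

definition grid :: "nat \<Rightarrow> nat \<Rightarrow> (nat \<times> nat) ugraph" where
  "grid m n =
     ({1..m} \<times> {1..n},
      {{(i, j), (i, j + 1)} | i j. 1 \<le> i \<and> i \<le> m \<and> 1 \<le> j \<and> j \<le> n - 1} \<union>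
      {{(i, j), (i + 1, j)} | i j. 1 \<le> i \<and> i \<le> m - 1 \<and> 1 \<le> j \<and> j \<le> n})"

text \<open>
  The list \<open>[v1, ..., vq]\<close> represents the closed walk \<open>(v1, ..., vq, v1)\<close>.
  The bound \<open>3 \<le> length c\<close> excludes walking an edge back and forth:
  \<open>(u, v, u)\<close> is a closed walk without further repetitions, but not a cycle
  of a simple graph.
\<close>

definition is_cycle :: "'a ugraph \<Rightarrow> 'a list \<Rightarrow> bool" where
  "is_cycle G c \<longleftrightarrow>
     3 \<le> length c \<and> distinct c \<and> set c \<subseteq> verts G \<and>
     (\<forall>k < length c. {c ! k, c ! (Suc k mod length c)} \<in> edges G)"

definition I_cc :: "'a ugraph \<Rightarrow> 'a set \<Rightarrow> 'a set" where
  "I_cc G S = S \<union> {v \<in> verts G. \<exists>c. is_cycle G c \<and> set c - S = {v}}"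

definition cc_convex :: "'a ugraph \<Rightarrow> 'a set \<Rightarrow> bool" where
  "cc_convex G S \<longleftrightarrow> S \<subseteq> verts G \<and> I_cc G S = S"

text \<open>
  \<open>P hull S\<close> is the intersection of all sets containing \<open>S\<close> that satisfy \<open>P\<close>;
  the lemmas below show that here it is the smallest such set.
\<close>

definition cc_hull :: "'a ugraph \<Rightarrow> 'a set \<Rightarrow> 'a set" where
  "cc_hull G S = cc_convex G hull S"

lemma cc_convex_Inter:
  assumes "\<F> \<noteq> {}" and "\<And>T. T \<in> \<F> \<Longrightarrow> cc_convex G T"
  shows "cc_convex G (\<Inter>\<F>)"
proof -
  have closed: "v \<in> T" if v: "v \<in> I_cc G (\<Inter>\<F>)" and T: "T \<in> \<F>" for v T
  proof (rule ccontr)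
    assume "v \<notin> T"
    with T have "v \<notin> \<Inter>\<F>" by blast
    with v obtain c where c: "v \<in> verts G" "is_cycle G c" "set c - \<Inter>\<F> = {v}"
      unfolding I_cc_def by blast
    from c(3) T \<open>v \<notin> T\<close> have "set c - T = {v}" by blast
    with c have "v \<in> I_cc G T" unfolding I_cc_def by blast
    with assms(2)[OF T] \<open>v \<notin> T\<close> show False by (simp add: cc_convex_def)
  qed
  have "I_cc G (\<Inter>\<F>) \<subseteq> \<Inter>\<F>" using closed by blast
  moreover have "\<Inter>\<F> \<subseteq> I_cc G (\<Inter>\<F>)" unfolding I_cc_def by blast
  moreover from assms(1) obtain T where "T \<in> \<F>" by blast
  then have "\<Inter>\<F> \<subseteq> verts G"
    using assms(2)[of T] unfolding cc_convex_def by blast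
  ultimately show ?thesis unfolding cc_convex_def by blast
qed

lemma cc_convex_cc_hull:
  assumes "S \<subseteq> verts G"
  shows "cc_convex G (cc_hull G S)"
proof -
  have "cc_convex G (verts G)" by (auto simp: cc_convex_def I_cc_def)
  with assms show ?thesis
    unfolding cc_hull_def hull_def by (intro cc_convex_Inter) auto
qed

lemma cc_hull_superset: "S \<subseteq> cc_hull G S"
  by (simp add: cc_hull_def hull_subset)

lemma cc_hull_least: "cc_convex G T \<Longrightarrow> S \<subseteq> T \<Longrightarrow> cc_hull G S \<subseteq> T"
  by (simp add: cc_hull_def hull_minimal)

definition is_hull_set :: "'a ugraph \<Rightarrow> 'a set \<Rightarrow> bool" where
  "is_hull_set G S \<longleftrightarrow> S \<subseteq> verts G \<and> cc_hull G S = verts G"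

text \<open>
  Meaningful for finite graphs, where the set of cardinalities is finite, and
  nonempty since \<open>verts G\<close> is a hull set.
\<close>

definition hn_cc :: "'a ugraph \<Rightarrow> nat" where
  "hn_cc G = Min (card ` {S. is_hull_set G S})"

end

theory Submission
  imports Defs "HOL-Number_Theory.Cong"
begin

text \<open>
  Read a vertex \<open>(i, j)\<close> of the grid as an edge between row \<open>i\<close> and column \<open>j\<close> of the complete
  bipartite graph on the \<open>m + n\<close> rows and columns. Let \<open>S\<close> be a hull set and label rows and columns
  so that the labels agree on the edges in \<open>S\<close>. The vertices whose row and column have equal labels
  form a convex set: if a cycle lies in this set except for one vertex \<open>v\<close>, then the rest of the cycle
  is a path, hence carries a single label, and by a discrete intermediate value argument it meets
  both the row and the column of \<open>v\<close>. Hence all labels are equal, so \<open>S\<close> is the edge set of a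
  connected graph on \<open>m + n\<close> vertices and has at least \<open>m + n - 1\<close> elements. Conversely, the first
  row and the first column together generate the whole grid through its 4-cycles.
\<close>

section \<open>Convex sets and hull sets\<close>

lemma verts_grid [simp]: "verts (grid m n) = {1..m} \<times> {1..n}"
  by (simp add: grid_def)

lemma is_hull_setI:
  assumes "S \<subseteq> verts G" and "\<And>T. cc_convex G T \<Longrightarrow> S \<subseteq> T \<Longrightarrow> verts G \<subseteq> T"
  shows "is_hull_set G S"
  using assms cc_convex_cc_hull[of S G] cc_hull_superset[of S G]
  by (auto simp: is_hull_set_def cc_convex_def)

lemma cc_convexI:
  assumes "T \<subseteq> verts G"
    and "\<And>c v. is_cycle G c \<Longrightarrow> v \<in> set c \<Longrightarrow> v \<in> verts G \<Longrightarrow> set c - {v} \<subseteq> T \<Longrightarrow> v \<in> T"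
  shows "cc_convex G T"
proof -
  have "v \<in> T" if "v \<in> verts G" "is_cycle G c" "set c - T = {v}" for v c
    by (rule assms(2)[OF that(2)]) (use that in blast)+
  then have "I_cc G T \<subseteq> T" unfolding I_cc_def by blast
  then show ?thesis using assms(1) by (auto simp: cc_convex_def I_cc_def)
qed

lemma cc_convex_superset_hull_set:
  assumes "is_hull_set G S" and "cc_convex G T" and "S \<subseteq> T"
  shows "verts G \<subseteq> T"
  using assms cc_hull_least[of G T S] by (simp add: is_hull_set_def)

lemma cc_convex_cycleD:
  assumes "cc_convex G T" and "is_cycle G c" and "set c \<subseteq> insert v T" and "v \<in> set c"
  shows "v \<in> T"
proof (rule ccontr)
  assume "v \<notin> T"
  with assms(3,4) have "set c - T = {v}" by blast
  moreover have "v \<in> verts G" using assms(2,4) by (auto simp: is_cycle_def)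
  ultimately have "v \<in> I_cc G T" using assms(2) by (auto simp: I_cc_def)
  with assms(1) \<open>v \<notin> T\<close> show False by (simp add: cc_convex_def)
qed

text \<open>Rotating the list to start at \<open>v\<close> and reading indices modulo its length
  gives a periodic walk, in which the closing edge is a step like any other.\<close>

lemma is_cycle_walk:
  assumes "is_cycle G c" and "v \<in> set c"
  obtains p where "\<And>t. {p t, p (Suc t)} \<in> edges G" and "\<And>t. p t \<in> set c"
    and "p 0 = v" and "p (length c) = v" and "inj_on p {..<length c}"
proof -
  obtain k where k: "k < length c" "c ! k = v"
    using assms(2) by (auto simp: in_set_conv_nth)
  define q where "q = length c"
  have q: "0 < q" "k < q" using k by (auto simp: q_def)
  define p where "p t = c ! ((k + t) mod q)" for t
  have "inj_on p {..<q}"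
  proof (rule inj_onI)
    fix s t assume st: "s \<in> {..<q}" "t \<in> {..<q}" "p s = p t"
    have "distinct c" using assms(1) by (simp add: is_cycle_def)
    then have "[k + s = k + t] (mod q)"
      using st(3) q by (simp add: p_def q_def nth_eq_iff_index_eq cong_def)
    then show "s = t"
      using st(1,2) by (simp add: cong_add_lcancel_nat cong_less_modulus_unique_nat)
  qed
  moreover have "{p t, p (Suc t)} \<in> edges G" for t
  proof -
    have "(k + t) mod q < length c" using q by (simp add: q_def)
    then have "{c ! ((k + t) mod q), c ! (Suc ((k + t) mod q) mod q)} \<in> edges G"
      using assms(1) by (simp add: is_cycle_def q_def)
    then show ?thesis by (simp add: p_def mod_Suc_eq)
  qed
  moreover have "p t \<in> set c" for t using q by (simp add: p_def q_def)
  ultimately show ?thesis using that[of p] k q by (simp add: p_def q_def)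
qed

section \<open>Cycles in the grid\<close>

lemma grid_edgeD:
  assumes "{a, b} \<in> edges (grid m n)"
  shows "fst a = fst b \<and> (snd b = Suc (snd a) \<or> snd a = Suc (snd b)) \<or>
         snd a = snd b \<and> (fst b = Suc (fst a) \<or> fst a = Suc (fst b))"
  using assms by (auto simp: grid_def doubleton_eq_iff)

text \<open>Discrete intermediate values: a sequence with steps of size at most one cannot change
  sides of \<open>c\<close> without taking the value \<open>c\<close>.\<close>

lemma unit_steps_same_side:
  fixes h :: "nat \<Rightarrow> nat"
  assumes "\<And>t. h (Suc t) \<le> Suc (h t) \<and> h t \<le> Suc (h (Suc t))"
    and "\<And>t. 1 \<le> t \<Longrightarrow> t \<le> N \<Longrightarrow> h t \<noteq> c" and "1 \<le> t" and "t \<le> N"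
  shows "h t < c \<longleftrightarrow> h 1 < c"
  using assms(3,4)
proof (induction t rule: dec_induct)
  case base
  show ?case ..
next
  case (step t)
  then show ?case using assms(1)[of t] assms(2)[of t] assms(2)[of "Suc t"] by force
qed

text \<open>If \<open>h\<close> avoided \<open>h 0\<close> in between, \<open>h 1\<close> and
  \<open>h (q - 1)\<close> would lie on the same side of it at distance one, hence be equal.\<close>

lemma closed_walk_meets_level:
  fixes h :: "nat \<Rightarrow> nat"
  assumes steps: "\<And>t. h (Suc t) \<le> Suc (h t) \<and> h t \<le> Suc (h (Suc t))"
    and "2 \<le> q" and "h (q - 1) \<noteq> h 1" and "h q = h 0"
  obtains t where "1 \<le> t" and "t < q" and "h t = h 0"
proof -
  have "\<exists>t. 1 \<le> t \<and> t \<le> q - 1 \<and> h t = h 0"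
  proof (rule ccontr)
    assume "\<not> ?thesis"
    then have avoid: "h t \<noteq> h 0" if "1 \<le> t" "t \<le> q - 1" for t using that by blast
    have "h (q - 1) < h 0 \<longleftrightarrow> h 1 < h 0"
      using unit_steps_same_side[of h "q - 1" "h 0" "q - 1"] steps avoid assms(2) by simp
    moreover have "h 1 \<noteq> h 0" "h (q - 1) \<noteq> h 0" using avoid[of 1] avoid[of "q - 1"] assms(2) by auto
    moreover have "h 1 \<le> Suc (h 0) \<and> h 0 \<le> Suc (h 1)" using steps[of 0] by simp
    moreover have "h q \<le> Suc (h (q - 1)) \<and> h (q - 1) \<le> Suc (h q)"
      using steps[of "q - 1"] assms(2) by simp
    ultimately show False using assms(3,4) by linarith
  qed
  then show ?thesis using that assms(2) by auto
qed

text \<open>If neither neighbour of \<open>p 0\<close> on the cycle lies in its row, both lie in its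
  column, on opposite sides, so the rest of the cycle must cross that row. Columns are
  symmetric.\<close>

lemma grid_cycle_meets_row_column:
  assumes edge: "\<And>t. {p t, p (Suc t)} \<in> edges (grid m n)"
    and closed: "p q = p 0" and q: "3 \<le> q" and inj: "inj_on p {..<q}"
  shows "\<exists>t. 1 \<le> t \<and> t < q \<and> fst (p t) = fst (p 0)"
    and "\<exists>t. 1 \<le> t \<and> t < q \<and> snd (p t) = snd (p 0)"
proof -
  have first: "fst (p 0) = fst (p 1) \<or> snd (p 0) = snd (p 1)"
    using grid_edgeD[OF edge[of 0]] by auto
  have last: "fst (p (q - 1)) = fst (p 0) \<or> snd (p (q - 1)) = snd (p 0)"
    using grid_edgeD[OF edge[of "q - 1"]] closed q by auto
  \<comment> \<open>Since \<open>q\<close> is at least 3, the two neighbours of \<open>p 0\<close>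
    on the cycle are distinct.\<close>
  have "p 1 \<noteq> p (q - 1)" using inj_onD[OF inj, of 1 "q - 1"] q by auto
  then have neq: "fst (p (q - 1)) \<noteq> fst (p 1) \<or> snd (p (q - 1)) \<noteq> snd (p 1)"
    by (metis prod.expand)
  have ends: "\<exists>t. 1 \<le> t \<and> t < q \<and> P (p t)" if "P (p 1) \<or> P (p (q - 1))" for P
  proof -
    have "(1::nat) \<le> 1" "1 < q" "1 \<le> q - 1" "q - 1 < q" using q by auto
    with that show ?thesis by blast
  qed
  show "\<exists>t. 1 \<le> t \<and> t < q \<and> fst (p t) = fst (p 0)"
  proof (cases "fst (p 1) = fst (p 0) \<or> fst (p (q - 1)) = fst (p 0)")
    case True
    then show ?thesis by (rule ends)
  next
    case False
    with first last neq have "fst (p (q - 1)) \<noteq> fst (p 1)" by auto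
    moreover have "fst (p (Suc t)) \<le> Suc (fst (p t)) \<and> fst (p t) \<le> Suc (fst (p (Suc t)))" for t
      using grid_edgeD[OF edge[of t]] by auto
    ultimately show ?thesis
      using closed_walk_meets_level[of "\<lambda>t. fst (p t)" q] closed q by force
  qed
  show "\<exists>t. 1 \<le> t \<and> t < q \<and> snd (p t) = snd (p 0)"
  proof (cases "snd (p 1) = snd (p 0) \<or> snd (p (q - 1)) = snd (p 0)")
    case True
    then show ?thesis by (rule ends)
  next
    case False
    with first last neq have "snd (p (q - 1)) \<noteq> snd (p 1)" by auto
    moreover have "snd (p (Suc t)) \<le> Suc (snd (p t)) \<and> snd (p t) \<le> Suc (snd (p (Suc t)))" for t
      using grid_edgeD[OF edge[of t]] by auto
    ultimately show ?thesis
      using closed_walk_meets_level[of "\<lambda>t. snd (p t)" q] closed q by force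
  qed
qed

section \<open>Lower bound: labellings of rows and columns\<close>

lemma cc_convex_equal_labels:
  fixes f g :: "nat \<Rightarrow> 'b"
  shows "cc_convex (grid m n) {(i, j) \<in> {1..m} \<times> {1..n}. f i = g j}"
    (is "cc_convex ?G ?T")
proof (rule cc_convexI)
  show "?T \<subseteq> verts ?G" by auto
next
  fix c v
  assume c: "is_cycle ?G c" and vc: "v \<in> set c" and v: "v \<in> verts ?G" and cv: "set c - {v} \<subseteq> ?T"
  obtain p where p: "\<And>t. {p t, p (Suc t)} \<in> edges ?G" "\<And>t. p t \<in> set c"
      "p 0 = v" "p (length c) = v" "inj_on p {..<length c}"
    by (rule is_cycle_walk[OF c vc]) (rule that)
  define q where "q = length c"
  have q: "3 \<le> q" using c by (simp add: is_cycle_def q_def)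
  have inj: "inj_on p {..<q}" using p(5) by (simp add: q_def)
  have inT: "p t \<in> ?T" if "1 \<le> t" "t < q" for t
  proof -
    have "p t \<noteq> p 0" using inj_onD[OF inj, of t 0] that by auto
    then have "p t \<in> set c - {v}" using p(2)[of t] p(3) by simp
    then show ?thesis by (rule subsetD[OF cv])
  qed
  have row_col: "f (fst (p t)) = g (snd (p t))" if "1 \<le> t" "t < q" for t
    using inT[OF that] by auto
  \<comment> \<open>Consecutive vertices share a row or a column, and in \<open>?T\<close> row and
    column labels agree, so one label is carried along the path.\<close>
  have label: "f (fst (p t)) = f (fst (p 1))" if "1 \<le> t" "t < q" for t
    using that
  proof (induction t rule: dec_induct)
    case base
    show ?case ..
  next
    case (step t)
    then show ?case
      using grid_edgeD[OF p(1)[of t]] row_col[of t] row_col[of "Suc t"] by auto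
  qed
  have "p q = p 0" using p(3,4) by (simp add: q_def)
  note meets = grid_cycle_meets_row_column[OF p(1) this q inj]
  from meets obtain s t where "1 \<le> s" "s < q" "fst (p s) = fst (p 0)"
      "1 \<le> t" "t < q" "snd (p t) = snd (p 0)" by blast
  \<comment> \<open>\<open>p s\<close> supplies the row label of \<open>v\<close> and
    \<open>p t\<close> its column label; both equal the label of the path.\<close>
  then have "f (fst v) = g (snd v)"
    using label[of s] label[of t] row_col[of t] p(3) by simp
  then show "v \<in> ?T" using v by auto
qed

text \<open>
  A graph with vertex set \<open>V\<close> and edge set \<open>E\<close> has at least \<open>card V - card E\<close> components; the
  labelling below separates components.
\<close>

lemma ex_labelling_many_values:
  assumes "finite E" and "finite V"
  shows "\<exists>f :: 'a \<Rightarrow> 'a. (\<forall>(a, b) \<in> E. f a = f b) \<and> card V \<le> card (f ` V) + card E"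
  using assms(1)
proof (induction E)
  case empty
  show ?case by (intro exI[of _ id]) simp
next
  case (insert e E)
  obtain a b where e: "e = (a, b)" by fastforce
  from insert.IH obtain f :: "'a \<Rightarrow> 'a"
    where f: "\<forall>(x, y) \<in> E. f x = f y" "card V \<le> card (f ` V) + card E" by blast
  \<comment> \<open>Merging the class of \<open>b\<close> into that of \<open>a\<close> respects the
    new edge and loses at most the value \<open>f b\<close>.\<close>
  define f' where "f' x = (if f x = f b then f a else f x)" for x
  have "f ` V \<subseteq> insert (f b) (f' ` V)" by (auto simp: f'_def)
  then have "card (f ` V) \<le> Suc (card (f' ` V))"
    using card_mono[of "insert (f b) (f' ` V)" "f ` V"] assms(2)
    by (auto simp: card_insert_if split: if_splits)
  moreover have "\<forall>(x, y) \<in> insert e E. f' x = f' y" using f(1) e by (auto simp: f'_def)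
  ultimately show ?case using f(2) insert.hyps by (intro exI[of _ f']) auto
qed

lemma card_hull_set_grid_ge:
  assumes S: "is_hull_set (grid m n) S" and "m \<ge> 1" and "n \<ge> 1"
  shows "m + n - 1 \<le> card S"
proof -
  \<comment> \<open>The sum type keeps row \<open>i\<close> and column \<open>i\<close>
    apart.\<close>
  define V :: "(nat + nat) set" where "V = {1..m} <+> {1..n}"
  define E :: "((nat + nat) \<times> (nat + nat)) set" where "E = (\<lambda>(i, j). (Inl i, Inr j)) ` S"
  have SG: "S \<subseteq> {1..m} \<times> {1..n}" using S by (simp add: is_hull_set_def)
  then have "finite S" by (rule finite_subset) simp
  then have "finite E" "card E \<le> card S" by (auto simp: E_def card_image_le)
  moreover have "finite V" "card V = m + n" by (auto simp: V_def card_Plus)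
  ultimately obtain f :: "nat + nat \<Rightarrow> nat + nat"
    where f: "\<forall>(a, b) \<in> E. f a = f b" and card: "m + n \<le> card (f ` V) + card S"
    using ex_labelling_many_values[of E V] by fastforce
  have "S \<subseteq> {(i, j) \<in> {1..m} \<times> {1..n}. f (Inl i) = f (Inr j)}" (is "_ \<subseteq> ?T")
    using f SG by (force simp: E_def)
  moreover have "cc_convex (grid m n) ?T" by (rule cc_convex_equal_labels)
  ultimately have "verts (grid m n) \<subseteq> ?T" using cc_convex_superset_hull_set[OF S] by blast
  then have eq: "f (Inl i) = f (Inr j)" if "i \<in> {1..m}" "j \<in> {1..n}" for i j
    using that by (auto dest: subsetD[of _ _ "(i, j)"])
  \<comment> \<open>Row 1 shares its label with every column, and column 1 with every row, so only
    one label is left.\<close>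
  have "f ` V \<subseteq> {f (Inl 1)}"
    using eq[of _ 1] eq[of 1] assms(2,3) by (auto simp: V_def)
  then have "card (f ` V) \<le> 1" using card_mono[of "{f (Inl 1)}"] by simp
  with card show ?thesis by linarith
qed

section \<open>Upper bound: first row and first column\<close>

lemma is_cycle_grid_square:
  assumes "1 \<le> i" "i < m" "1 \<le> j" "j < n"
  shows "is_cycle (grid m n) [(i, j), (Suc i, j), (Suc i, Suc j), (i, Suc j)]"
proof -
  have horizontal: "{(x, j), (x, Suc j)} \<in> edges (grid m n)" if "1 \<le> x" "x \<le> m" for x
    using that assms unfolding grid_def snd_conv
    by (intro UnI1 CollectI exI[of _ x] exI[of _ j]) auto
  have vertical: "{(i, y), (Suc i, y)} \<in> edges (grid m n)" if "1 \<le> y" "y \<le> n" for y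
    using that assms unfolding grid_def snd_conv
    by (intro UnI2 CollectI exI[of _ i] exI[of _ y]) auto
  show ?thesis
    using horizontal[of i] horizontal[of "Suc i"] vertical[of j] vertical[of "Suc j"] assms
    by (simp add: is_cycle_def All_less_Suc insert_commute)
qed

text \<open>Rows are filled one after another, each by increasing \<open>j\<close>: when
  \<open>(Suc i, Suc j)\<close> is reached, the other three corners of its unit square are already
  in \<open>T\<close>.\<close>

lemma is_hull_set_grid_row_column:
  assumes "m \<ge> 1" and "n \<ge> 1"
  shows "is_hull_set (grid m n) ({1..m} \<times> {1} \<union> {1} \<times> {2..n})" (is "is_hull_set _ ?S")
proof (rule is_hull_setI)
  show "?S \<subseteq> verts (grid m n)" using assms by auto
next
  fix T assume T: "cc_convex (grid m n) T" "?S \<subseteq> T"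
  have "\<forall>j. 1 \<le> j \<longrightarrow> j \<le> n \<longrightarrow> (i, j) \<in> T" if "1 \<le> i" "i \<le> m" for i
    using that
  proof (induction i rule: dec_induct)
    case base
    show ?case
    proof (intro allI impI)
      fix j assume "1 \<le> j" "j \<le> n"
      then have "(1, j) \<in> ?S" using assms by (cases "j = 1") auto
      with T(2) show "(1, j) \<in> T" by blast
    qed
  next
    case (step i)
    have row: "(i, y) \<in> T" if "1 \<le> y" "y \<le> n" for y
      using step.IH step.prems that by simp
    have "(Suc i, j) \<in> T" if "1 \<le> j" "j \<le> n" for j
      using that
    proof (induction j rule: dec_induct)
      case base
      have "(Suc i, 1) \<in> ?S" using step.prems by auto
      with T(2) show ?case by blast
    next
      case (step j)
      have "is_cycle (grid m n) [(i, j), (Suc i, j), (Suc i, Suc j), (i, Suc j)]"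
        using step \<open>1 \<le> i\<close> \<open>Suc i \<le> m\<close> by (intro is_cycle_grid_square) auto
      then show ?case
        by (rule cc_convex_cycleD[OF T(1)])
          (use step.hyps step.IH step.prems row in auto)
    qed
    then show ?case by blast
  qed
  then show "verts (grid m n) \<subseteq> T" by auto
qed

theorem theorem3:
  fixes m n :: nat
  assumes "m \<ge> 1" and "n \<ge> 1"
  shows "hn_cc (grid m n) = m + n - 1"
  unfolding hn_cc_def
proof (rule Min_eqI)
  have "{S. is_hull_set (grid m n) S} \<subseteq> Pow (verts (grid m n))"
    by (auto simp: is_hull_set_def)
  then show "finite (card ` {S. is_hull_set (grid m n) S})"
    by (intro finite_imageI) (rule finite_subset, auto)
next
  fix k assume "k \<in> card ` {S. is_hull_set (grid m n) S}"
  then show "m + n - 1 \<le> k" using card_hull_set_grid_ge assms by auto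
next
  \<comment> \<open>The second part starts at column 2, so the two are disjoint and their sizes
    \<open>m\<close> and \<open>n - 1\<close> add up.\<close>
  have "card ({1..m} \<times> {1::nat} \<union> {1} \<times> {2..n}) = m + n - 1"
    using assms(2) by (subst card_Un_disjoint) (auto simp: card_cartesian_product)
  then show "m + n - 1 \<in> card ` {S. is_hull_set (grid m n) S}"
    using is_hull_set_grid_row_column[OF assms] by (metis imageI mem_Collect_eq)
qed

end
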